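(* Let $N\ge 1$, let $\varepsilon>0$, and let $x_1<x_2<\cdots<x_N$ and $y_1<y_2<\cdots<y_N$ be real numbers. Let $\zeta$ be the dividing index of these meshes and let $K_U=[\hat k_{ij}]\in\mathbb{R}^{N\times N}$ be the upper block induced by $\zeta$. Define the ratio vector $\boldsymbol r'=(r'_1,\dots,r'_{N-1})\in\mathbb{R}^{N-1}$ by $$r'_i=\frac{\hat k_{i,N}}{\hat k_{i+1,N}},\qquad i=1,\dots,N-1,$$ with the convention $r'_i=1$ if $\hat k_{i+1,N}=0$, and define the block-edge (row) vectors $$\boldsymbol\eta'_i=[\hat k_{i,\zeta(i)+1},\dots,\hat k_{i,\zeta(i+1)}],\qquad i=1,\dots,N,$$ with the convention $\zeta(N+1)=N$ ($\boldsymbol\eta'_i$ is empty when $\zeta(i)=\zeta(i+1)$). Then the vectors $\boldsymbol\eta'_1,\dots,\boldsymbol\eta'_N$ have a total of $N-\zeta(1)$ entries, and $K_U$ has the representation $$K_U=\begin{pmatrix}\ &\boldsymbol\eta'_1&\cdots&\cdots&\prod_{t=1}^{N-2}r'_t\,\boldsymbol\eta'_{N-1}&\prod_{t=1}^{N-1}r'_t\,\boldsymbol\eta'_N\\ &&\ddots&\vdots&\vdots&\vdots\\ &&&\boldsymbol\eta'_{N-2}&r'_{N-2}\boldsymbol\eta'_{N-1}&r'_{N-2}r'_{N-1}\boldsymbol\eta'_N\\ &&&&\boldsymbol\eta'_{N-1}&r'_{N-1}\boldsymbol\eta'_N\\ &&&&&\boldsymbol\eta'_N\end{pmatrix},$$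 where blank positions are zero. That is, for all $1\le i,s\le N$, the restriction of row $i$ of $K_U$ to the columns $\zeta(s)+1,\dots,\zeta(s+1)$ equals $\bigl(\prod_{t=i}^{s-1}r'_t\bigr)\boldsymbol\eta'_s$ if $s\ge i$ (empty product $=1$) and equals $0$ if $s<i$, and all columns of $K_U$ with index at most $\zeta(1)$ are zero.
   Context: The dividing index of the sorted meshes $x_1<\cdots<x_N$, $y_1<\cdots<y_N$ is the map $\zeta:\{1,\dots,N\}\to\{0,1,\dots,N\}$ defined as follows: if $y_1\le x_i<y_N$, then $\zeta(i)$ is the unique index with $y_{\zeta(i)}\le x_i<y_{\zeta(i)+1}$; if $x_i<y_1$, then $\zeta(i)=0$; if $x_i\ge y_N$, then $\zeta(i)=N$. The kernel matrix is $K=[k_{ij}]\in\mathbb{R}^{N\times N}$ with $k_{ij}=e^{-|x_i-y_j|/\varepsilon}$. The upper block $K_U=[\hat k_{ij}]\in\mathbb{R}^{N\times N}$ induced by $\zeta$ is defined by $\hat k_{ij}=0$ for $1\le j\le\zeta(i)$ and $\hat k_{ij}=k_{ij}=e^{-(y_j-x_i)/\varepsilon}$ for $\zeta(i)<j\le N$. *)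

theory Defs
  imports Complex_Main "Jordan_Normal_Form.Matrix"
begin

text \<open>
  Meshes are functions \<open>x, y :: nat \<Rightarrow> real\<close> of which only the values at \<open>1, \<dots>, N\<close> are used.
  Library matrices are indexed from 0, so \<open>entry A i j\<close> is the entry in the usual 1-based numbering.
\<close>

definition entry :: "'a mat \<Rightarrow> nat \<Rightarrow> nat \<Rightarrow> 'a" where
  "entry A i j = A $$ (i - 1, j - 1)"

text \<open>The entries of row \<open>i\<close> in the columns \<open>a, \<dots>, b\<close> (1-based, empty if \<open>b < a\<close>).\<close>

definition row_segment :: "'a mat \<Rightarrow> nat \<Rightarrow> nat \<Rightarrow> nat \<Rightarrow> 'a list" where
  "row_segment A i a b = map (entry A i) [a..<b + 1]"

text \<open>
  The branches after the first are the dividing index proper, on \<open>1, \<dots>, N\<close>; the first is the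
  convention that its value at \<open>N + 1\<close> is \<open>N\<close>.
\<close>

definition dividing_index :: "nat \<Rightarrow> (nat \<Rightarrow> real) \<Rightarrow> (nat \<Rightarrow> real) \<Rightarrow> nat \<Rightarrow> nat" where
  "dividing_index N x y i =
     (if i = N + 1 then N
      else if x i < y 1 then 0
      else if x i \<ge> y N then N
      else (THE l. 1 \<le> l \<and> l + 1 \<le> N \<and> y l \<le> x i \<and> x i < y (l + 1)))"

definition kernel_matrix :: "nat \<Rightarrow> real \<Rightarrow> (nat \<Rightarrow> real) \<Rightarrow> (nat \<Rightarrow> real) \<Rightarrow> real mat" where
  "kernel_matrix N \<epsilon> x y = mat N N (\<lambda>(i, j). exp (- \<bar>x (i + 1) - y (j + 1)\<bar> / \<epsilon>))"

definition upper_block :: "nat \<Rightarrow> real \<Rightarrow> (nat \<Rightarrow> real) \<Rightarrow> (nat \<Rightarrow> real) \<Rightarrow> real mat" where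
  "upper_block N \<epsilon> x y =
     mat N N (\<lambda>(i, j). if j + 1 \<le> dividing_index N x y (i + 1) then 0
                       else kernel_matrix N \<epsilon> x y $$ (i, j))"

definition upper_ratio :: "nat \<Rightarrow> real \<Rightarrow> (nat \<Rightarrow> real) \<Rightarrow> (nat \<Rightarrow> real) \<Rightarrow> nat \<Rightarrow> real" where
  "upper_ratio N \<epsilon> x y i =
     (if entry (upper_block N \<epsilon> x y) (i + 1) N = 0 then 1
      else entry (upper_block N \<epsilon> x y) i N / entry (upper_block N \<epsilon> x y) (i + 1) N)"

definition upper_edge :: "nat \<Rightarrow> real \<Rightarrow> (nat \<Rightarrow> real) \<Rightarrow> (nat \<Rightarrow> real) \<Rightarrow> nat \<Rightarrow> real list" where
  "upper_edge N \<epsilon> x y i =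
     row_segment (upper_block N \<epsilon> x y) i
       (dividing_index N x y i + 1) (dividing_index N x y (i + 1))"

text \<open>
  The block upper triangular matrix with \<open>N\<close> rows and columns built from the ratios \<open>r\<close> and the row
  vectors \<open>\<eta>\<close>: row \<open>i\<close> consists of \<open>m\<close> zeros followed by the blocks \<open>s = 1, \<dots>, N\<close>, where block \<open>s\<close>
  is \<open>r i * \<dots> * r (s - 1)\<close> times \<open>\<eta> s\<close> if \<open>i \<le> s\<close>, and a zero block of the same length otherwise.
\<close>

definition block_triangular ::
    "nat \<Rightarrow> nat \<Rightarrow> (nat \<Rightarrow> real) \<Rightarrow> (nat \<Rightarrow> real list) \<Rightarrow> real mat" where
  "block_triangular N m r \<eta> =
     mat_of_rows_list N
       (map (\<lambda>i. replicate m 0 @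
              concat (map (\<lambda>s. if i \<le> s then map (\<lambda>c. (\<Prod>t = i..<s. r t) * c) (\<eta> s)
                                else replicate (length (\<eta> s)) 0) [1..<N + 1]))
         [1..<N + 1])"

end

theory Submission
  imports Defs
begin

text \<open>
  For \<open>i, j\<close> in \<open>1, \<dots>, N\<close> one has \<open>j \<le> \<zeta>(i)\<close> iff \<open>y j \<le> x i\<close>. Hence \<open>\<zeta>\<close> is monotone, the blocks
  of columns between consecutive values of \<open>\<zeta>\<close> tile the columns after \<open>\<zeta>(1)\<close>, and the nonzero
  entries of the upper block are the separable quantities \<open>exp (x i / \<epsilon>) * exp (- y j / \<epsilon>)\<close>. If
  block \<open>s\<close> contains a column \<open>j\<close>, then \<open>x s < y j \<le> y N\<close>, so the last entries of the rows \<open>i, \<dots>, s\<close>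
  do not vanish and the ratios \<open>r t = exp ((x t - x (t + 1)) / \<epsilon>)\<close> telescope from row \<open>i\<close> to row \<open>s\<close>.
\<close>

text \<open>Discrete intermediate value argument on the last index: either \<open>a < y n\<close>
  and an earlier bracket exists, or \<open>n\<close> itself brackets \<open>a\<close>.\<close>

lemma ex_bracketing_index:
  fixes y :: "nat \<Rightarrow> real"
  assumes "y 1 \<le> a" "a < y N" "1 \<le> N"
  shows "\<exists>l. 1 \<le> l \<and> l + 1 \<le> N \<and> y l \<le> a \<and> a < y (l + 1)"
  using assms(3,2)
proof (induction N rule: dec_induct)
  case base
  then show ?case using assms(1) by simp
next
  case (step n)
  show ?case
  proof (cases "a < y n")
    case True
    then obtain l where "1 \<le> l \<and> l + 1 \<le> n \<and> y l \<le> a \<and> a < y (l + 1)"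
      using step.IH by blast
    then show ?thesis by (intro exI[of _ l]) auto
  next
    case False
    then show ?thesis using step by (intro exI[of _ n]) auto
  qed
qed

text \<open>Later proofs reason through this threshold criterion instead of the definite
  description: \<open>dividing_index N x y i\<close> counts the mesh points \<open>y j\<close> not
  exceeding \<open>x i\<close>.\<close>

lemma dividing_index_le:
  fixes x y :: "nat \<Rightarrow> real"
  assumes y: "strict_mono_on {1..N} y" and i: "i \<in> {1..N}"
  shows "dividing_index N x y i \<le> N"
    and "j \<in> {1..N} \<Longrightarrow> j \<le> dividing_index N x y i \<longleftrightarrow> y j \<le> x i"
proof -
  have y_le: "y k \<le> y l" if "k \<in> {1..N}" "l \<in> {1..N}" "k \<le> l" for k l
    using strict_mono_on_imp_mono_on[OF y] that by (auto simp: mono_on_def)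
  consider "x i < y 1" | "y N \<le> x i" "y 1 \<le> x i" | "y 1 \<le> x i" "x i < y N" by linarith
  then have "dividing_index N x y i \<le> N \<and>
    (\<forall>j \<in> {1..N}. j \<le> dividing_index N x y i \<longleftrightarrow> y j \<le> x i)"
  proof cases
    case 1
    have "y 1 \<le> y j" if "j \<in> {1..N}" for j using y_le[of 1 j] that by auto
    then show ?thesis using 1 i by (force simp: dividing_index_def)
  next
    case 2
    have "y j \<le> y N" if "j \<in> {1..N}" for j using y_le[of j N] that by auto
    then show ?thesis using 2 i by (force simp: dividing_index_def)
  next
    case 3
    let ?P = "\<lambda>l. 1 \<le> l \<and> l + 1 \<le> N \<and> y l \<le> x i \<and> x i < y (l + 1)"
    obtain l where l: "?P l" using ex_bracketing_index[of y "x i" N] 3 i by auto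
    have iff: "j \<le> k \<longleftrightarrow> y j \<le> x i" if k: "?P k" and j: "j \<in> {1..N}" for j k
    proof
      assume "j \<le> k"
      then show "y j \<le> x i" using y_le[of j k] k j by auto
    next
      assume "y j \<le> x i"
      then show "j \<le> k" using y_le[of "k + 1" j] k j by (cases "k + 1 \<le> j") auto
    qed
    have "(THE l. ?P l) = l"
    proof (rule the_equality[of ?P, OF l])
      fix k assume k: "?P k"
      \<comment> \<open>Two brackets obey the same threshold criterion, so each is at most the
        other.\<close>
      show "k = l" using iff[OF k, of l] iff[OF l, of k] k l by auto
    qed
    then have "dividing_index N x y i = l" using 3 i by (simp add: dividing_index_def)
    then show ?thesis using l iff[OF l] by auto
  qed
  then show "dividing_index N x y i \<le> N"
    and "j \<in> {1..N} \<Longrightarrow> j \<le> dividing_index N x y i \<longleftrightarrow> y j \<le> x i" by blast+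
qed

text \<open>The set of \<open>j\<close> with \<open>y j \<le> x i\<close> grows with
  \<open>i\<close>. The range includes \<open>N + 1\<close> because the last block of columns ends
  at the conventional value there.\<close>

lemma dividing_index_mono:
  assumes x: "strict_mono_on {1..N} x" and y: "strict_mono_on {1..N} y"
    and ij: "i \<in> {1..N + 1}" "j \<in> {1..N + 1}" "i \<le> j"
  shows "dividing_index N x y i \<le> dividing_index N x y j"
proof (cases "j = N + 1")
  case True
  then show ?thesis
    using dividing_index_le(1)[OF y, of i x] ij by (cases "i = N + 1") (auto simp: dividing_index_def)
next
  case False
  then have ij': "i \<in> {1..N}" "j \<in> {1..N}" using ij by auto
  let ?k = "dividing_index N x y i"
  have "x i \<le> x j"
    using strict_mono_on_imp_mono_on[OF x] ij' ij(3) by (auto simp: mono_on_def)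
  \<comment> \<open>The criterion only speaks of indices from 1 on, so the value 0 is split off;
    otherwise \<open>y ?k \<le> x i \<le> x j\<close>.\<close>
  then show ?thesis
    using dividing_index_le(1)[OF y ij'(1), of x] dividing_index_le(2)[OF y ij'(1), of ?k x]
      dividing_index_le(2)[OF y ij'(2), of ?k x] by (cases "?k = 0") auto
qed

text \<open>Where \<open>x i < y j\<close>, the absolute value in the kernel has a known sign, which
  leaves an exponent linear in \<open>x i\<close> and \<open>y j\<close>.\<close>

lemma entry_upper_block:
  assumes y: "strict_mono_on {1..N} y" and i: "i \<in> {1..N}" and j: "j \<in> {1..N}"
  shows "entry (upper_block N \<epsilon> x y) i j = (if y j \<le> x i then 0 else exp ((x i - y j) / \<epsilon>))"
proof -
  have "i - 1 < N" "j - 1 < N" "Suc (i - 1) = i" "Suc (j - 1) = j" using i j by auto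
  then show ?thesis
    using dividing_index_le(2)[OF y i j, of x] minus_divide_left[of "y j - x i" \<epsilon>]
    by (auto simp: entry_def upper_block_def kernel_matrix_def)
qed

lemma prod_upper_ratio:
  assumes x: "strict_mono_on {1..N} x" and y: "strict_mono_on {1..N} y"
    and "i \<ge> 1" "s \<le> N" "x s < y N" "i \<le> s"
  shows "(\<Prod>t = i..<s. upper_ratio N \<epsilon> x y t) = exp ((x i - x s) / \<epsilon>)"
  using \<open>i \<le> s\<close> \<open>s \<le> N\<close> \<open>x s < y N\<close>
proof (induction s rule: dec_induct)
  case base
  then show ?case by simp
next
  case (step n)
  have n: "n \<in> {1..N}" "n + 1 \<in> {1..N}" "N \<in> {1..N}" using step \<open>i \<ge> 1\<close> by auto
  \<comment> \<open>Hence also \<open>x n < y N\<close>: both last entries in the ratio are nonzero,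
    so its default value 1 does not enter, and the induction hypothesis applies.\<close>
  have "x n < x (n + 1)" using strict_mono_onD[OF x n(1,2)] by simp
  then have "upper_ratio N \<epsilon> x y n = exp ((x n - x (n + 1)) / \<epsilon>)"
    using step.prems n
    by (simp add: upper_ratio_def entry_upper_block[OF y] flip: exp_diff diff_divide_distrib)
  moreover have "(\<Prod>t = i..<n. upper_ratio N \<epsilon> x y t) = exp ((x i - x n) / \<epsilon>)"
    using step \<open>x n < x (n + 1)\<close> by auto
  ultimately show ?case
    using step.hyps by (simp flip: exp_add add_divide_distrib)
qed

text \<open>In block \<open>s\<close>, each row \<open>i \<le> s\<close> is a multiple of row
  \<open>s\<close> because the entries separate. For \<open>i > s\<close>, monotonicity of \<zeta>
  puts the whole block into the zero part of row \<open>i\<close>.\<close>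

lemma row_segment_upper_block:
  assumes x: "strict_mono_on {1..N} x" and y: "strict_mono_on {1..N} y"
    and i: "i \<in> {1..N}" and s: "s \<in> {1..N}"
  shows "row_segment (upper_block N \<epsilon> x y) i
            (dividing_index N x y s + 1) (dividing_index N x y (s + 1)) =
          (if s \<ge> i
           then map (\<lambda>c. (\<Prod>t = i..<s. upper_ratio N \<epsilon> x y t) * c) (upper_edge N \<epsilon> x y s)
           else replicate (length (upper_edge N \<epsilon> x y s)) 0)"
proof -
  let ?z = "dividing_index N x y"
  have zN: "?z (s + 1) \<le> N"
    using dividing_index_mono[OF x y, of "s + 1" "N + 1"] s by (auto simp: dividing_index_def)
  have col: "j \<in> {1..N}" if "j \<in> set [?z s + 1..<?z (s + 1) + 1]" for j
    using that zN by auto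
  show ?thesis
  proof (cases "i \<le> s")
    case True
    have "entry (upper_block N \<epsilon> x y) i j =
        (\<Prod>t = i..<s. upper_ratio N \<epsilon> x y t) * entry (upper_block N \<epsilon> x y) s j"
      if j: "j \<in> set [?z s + 1..<?z (s + 1) + 1]" for j
    proof -
      have xs: "x s < y j" using dividing_index_le(2)[OF y s col[OF j], of x] j by auto
      have "y j \<le> y N"
        using strict_mono_on_imp_mono_on[OF y] col[OF j] by (auto simp: mono_on_def)
      then have prod: "(\<Prod>t = i..<s. upper_ratio N \<epsilon> x y t) = exp ((x i - x s) / \<epsilon>)"
        using prod_upper_ratio[OF x y] i s xs True by auto
      \<comment> \<open>Now \<open>x i \<le> x s < y j\<close>, so both entries in column
        \<open>j\<close> are exponentials and their exponents differ by
        \<open>(x i - x s) / \<epsilon>\<close>.\<close>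
      have "x i \<le> x s"
        using strict_mono_on_imp_mono_on[OF x] i s True by (auto simp: mono_on_def)
      then show ?thesis
        using xs by (simp add: prod entry_upper_block[OF y i col[OF j]]
            entry_upper_block[OF y s col[OF j]] flip: exp_add add_divide_distrib)
    qed
    then show ?thesis using True by (simp add: row_segment_def upper_edge_def)
  next
    case False
    have "entry (upper_block N \<epsilon> x y) i j = 0"
      if j: "j \<in> set [?z s + 1..<?z (s + 1) + 1]" for j
    proof -
      have "j \<le> ?z i"
        using dividing_index_mono[OF x y, of "s + 1" i] False i s j by auto
      then show ?thesis
        using dividing_index_le(2)[OF y i col[OF j], of x] entry_upper_block[OF y i col[OF j]]
        by auto
    qed
    then show ?thesis
      using False unfolding row_segment_def upper_edge_def
      by (auto simp del: upt_Suc intro!: replicate_eqI)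
  qed
qed

text \<open>Adjacent half-open intervals glue together. The inequality is carried along because the
  inductive step needs it to split the interval at \<open>z (n + 1)\<close>.\<close>

lemma concat_map_consecutive_segments:
  assumes "\<And>s. s \<in> {1..n} \<Longrightarrow> z s \<le> z (s + 1)"
  shows "z 1 \<le> z (n + 1) \<and> concat (map (\<lambda>s. map f [z s + 1..<z (s + 1) + 1]) [1..<n + 1]) =
    map f [z 1 + 1..<z (n + 1) + (1::nat)]"
  using assms
proof (induction n)
  case 0
  then show ?case by simp
next
  case (Suc n)
  have IH: "z 1 \<le> z (n + 1) \<and> concat (map (\<lambda>s. map f [z s + 1..<z (s + 1) + 1]) [1..<n + 1]) =
    map f [z 1 + 1..<z (n + 1) + 1]"
    using Suc by simp
  have z: "z (n + 1) \<le> z (n + 2)" using Suc.prems[of "n + 1"] by simp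
  have "[z 1 + 1..<z (n + 2) + 1] = [z 1 + 1..<z (n + 1) + 1] @ [z (n + 1) + 1..<z (n + 2) + 1]"
    using IH z upt_add_eq_append[of "z 1 + 1" "z (n + 1) + 1" "z (n + 2) - z (n + 1)"] by simp
  then show ?case using IH z by simp
qed

text \<open>Monotonicity makes the truncated differences genuine, so over the integers the sum
  telescopes.\<close>

lemma sum_consecutive_differences:
  fixes z :: "nat \<Rightarrow> nat"
  assumes "\<And>s. s \<in> {1..n} \<Longrightarrow> z s \<le> z (s + 1)"
  shows "int (\<Sum>s = 1..n. z (s + 1) - z s) = int (z (n + 1)) - int (z 1)"
proof -
  have "int (\<Sum>s = 1..n. z (s + 1) - z s) = (\<Sum>s = 1..n. int (z (Suc s)) - int (z s))"
    using assms by (simp add: of_nat_diff)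
  then show ?thesis using sum_Suc_diff[of 1 n "\<lambda>s. int (z s)"] by simp
qed

theorem theorem2p3:
  fixes N :: nat and \<epsilon> :: real and x y :: "nat \<Rightarrow> real"
  assumes "N \<ge> 1" and "\<epsilon> > 0"
    and "strict_mono_on {1..N} x" and "strict_mono_on {1..N} y"
  shows "int (\<Sum>i = 1..N. length (upper_edge N \<epsilon> x y i)) = int N - int (dividing_index N x y 1)
    \<and> upper_block N \<epsilon> x y =
        block_triangular N (dividing_index N x y 1) (upper_ratio N \<epsilon> x y) (upper_edge N \<epsilon> x y)
    \<and> (\<forall>i \<in> {1..N}. \<forall>s \<in> {1..N}.
        row_segment (upper_block N \<epsilon> x y) i
            (dividing_index N x y s + 1) (dividing_index N x y (s + 1)) =
          (if s \<ge> i
           then map (\<lambda>c. (\<Prod>t = i..<s. upper_ratio N \<epsilon> x y t) * c) (upper_edge N \<epsilon> x y s)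
           else replicate (length (upper_edge N \<epsilon> x y s)) 0))
    \<and> (\<forall>i \<in> {1..N}. \<forall>j \<in> {1..dividing_index N x y 1}. entry (upper_block N \<epsilon> x y) i j = 0)"
proof -
  note x = assms(3) and y = assms(4)
  let ?z = "dividing_index N x y" and ?K = "upper_block N \<epsilon> x y"
  \<comment> \<open>The convention makes the last block end exactly at the last column.\<close>
  have zN: "?z (N + 1) = N" by (simp add: dividing_index_def)
  have z_step: "?z s \<le> ?z (s + 1)" if "s \<in> {1..N}" for s
    using dividing_index_mono[OF x y, of s "s + 1"] that by auto
  have z1: "?z 1 \<le> N" using dividing_index_le(1)[OF y, of 1 x] assms(1) by auto
  have len: "int (\<Sum>i = 1..N. length (upper_edge N \<epsilon> x y i)) = int N - int (?z 1)"
    using sum_consecutive_differences[of N ?z, OF z_step]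
    by (simp add: upper_edge_def row_segment_def zN[simplified] del: upt_Suc)
  have zero: "entry ?K i j = 0" if i: "i \<in> {1..N}" and j: "j \<in> {1..?z 1}" for i j
  proof -
    have j': "j \<in> {1..N}" using j z1 by auto
    have "j \<le> ?z i" using dividing_index_mono[OF x y, of 1 i] i j by auto
    then show ?thesis
      using dividing_index_le(2)[OF y i j', of x] entry_upper_block[OF y i j'] by auto
  qed
  define block where "block i s = (if i \<le> s
      then map (\<lambda>c. (\<Prod>t = i..<s. upper_ratio N \<epsilon> x y t) * c) (upper_edge N \<epsilon> x y s)
      else replicate (length (upper_edge N \<epsilon> x y s)) 0)" for i s
  \<comment> \<open>The zero columns up to \<zeta>(1), followed by the blocks that tile the
    remaining columns, make up the full row \<open>i\<close>.\<close>
  have row: "replicate (?z 1) 0 @ concat (map (block i) [1..<N + 1]) = map (entry ?K i) [1..<N + 1]"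
    if i: "i \<in> {1..N}" for i
  proof -
    have "map (block i) [1..<N + 1] =
        map (\<lambda>s. map (entry ?K i) [?z s + 1..<?z (s + 1) + 1]) [1..<N + 1]"
    proof (intro map_cong refl)
      fix s assume "s \<in> set [1..<N + 1]"
      then have "s \<in> {1..N}" by auto
      from row_segment_upper_block[OF x y i this, of \<epsilon>]
      show "block i s = map (entry ?K i) [?z s + 1..<?z (s + 1) + 1]"
        unfolding block_def row_segment_def by (rule sym)
    qed
    then have blocks: "concat (map (block i) [1..<N + 1]) = map (entry ?K i) [?z 1 + 1..<N + 1]"
      using concat_map_consecutive_segments[of N ?z "entry ?K i", OF z_step]
      by (simp only: zN)
    have "map (entry ?K i) [1..<?z 1 + 1] = replicate (?z 1) 0"
      using zero[OF i] by (intro replicate_eqI) auto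
    moreover have "[1..<N + 1] = [1..<?z 1 + 1] @ [?z 1 + 1..<N + 1]"
      using upt_add_eq_append[of 1 "?z 1 + 1" "N - ?z 1"] z1 by (simp del: upt_Suc)
    ultimately show ?thesis using blocks by (metis map_append)
  qed
  have "block_triangular N (?z 1) (upper_ratio N \<epsilon> x y) (upper_edge N \<epsilon> x y) =
      mat_of_rows_list N (map (\<lambda>i. map (entry ?K i) [1..<N + 1]) [1..<N + 1])"
    unfolding block_triangular_def block_def[symmetric]
    by (intro arg_cong[of _ _ "mat_of_rows_list N"] map_cong refl row) auto
  \<comment> \<open>Reading off all entries row by row recovers the matrix: the 1-based ranges
    cancel the shifts by 1 in \<open>entry\<close>.\<close>
  also have "\<dots> = ?K"
    by (rule eq_matI)
      (auto simp: mat_of_rows_list_def entry_def upper_block_def simp del: upt_Suc)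
  finally show ?thesis
    using len zero row_segment_upper_block[OF x y, of _ _ \<epsilon>] by simp
qed

end
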